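(* Let $\mathrm{Alg}$ be an $\alpha$-competitive algorithm for the Online Knapsack Problem in the random order model. Then the Reduction Algorithm (with input $n$, $T$ and $\mathrm{Alg}$) is $(\mathrm{e}+\alpha)C$-competitive for the Reading Articles Online problem, i.e. for every instance $I$ of RAO with hint accuracy $C$, $\mathbb{E}[\text{Reduction Algorithm}(I)]\ge \mathrm{Opt}(I)/((\mathrm{e}+\alpha)C)$.
   Context: Notation: $[m]=\{1,\dots,m\}$. Reading Articles Online (RAO): there are $n$ articles revealed one by one; time budget $T\in\mathbb{N}_{>0}$. Article $i$ has a hint $h_i\in\mathbb{N}_{>0}$, a length $t_i\in\mathbb{N}_{>0}$ and an unknown information rate $c_i:[t_i]\to[h_i]$. When article $i$ arrives the reader sees $h_i,t_i$ and decides to start reading or to skip. After reading time step $j\le t_i$ the reader obtains $c_i(j)$ information units and decides whether to read the next time step or discard the article irrevocably; then the next article arrives. Objective: maximize $\sum_i\sum_{j=1}^{\tau_i}c_i(j)$, $\tau_i\le t_i$ the number of steps read of article $i$, $\sum_i\tau_i\le T$. The arrival order is a uniformly random permutation (random order model). An algorithm is $\beta$-competitive if for every instance $I$, $\mathbb{E}[\mathrm{Alg}(I)]\ge\mathrm{Opt}(I)/\beta$, expectation over the permutation and the algorithm's randomness, $\mathrm{Opt}(I)$ the optimal offline value. Accuracy of hints: $C\ge1$ is the smallest number with $h_i\le C\sum_{j=1}^{t_i}c_i(j)/t_i$ for all $i$. Standing assumptions: $t_i\le T$ for all $i$, and the hints $h_i$ are pairwise distinct and the values $t_ih_i$ are pairwise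 distinct. Online Knapsack Problem (random order model): items with values and weights arrive in uniformly random order; on arrival each must be irrevocably accepted or rejected, total accepted weight at most the capacity; $\alpha$-competitiveness is relative to the optimal offline knapsack value. Secretary Algorithm (on $n$ items with values): reject the first $\lfloor n/\mathrm{e}\rfloor$ items, then select the first item whose value exceeds that of every item seen so far (select exactly one item at most). Reduction Algorithm: set $\delta=\alpha/(\mathrm{e}+\alpha)$ and choose $b\in\{0,1\}$ at random with $\Pr[b=1]=\delta$. If $b=1$, run $\mathrm{Alg}$ on the arriving articles viewed as knapsack items with values $t_ih_i$, weights $t_i$ and capacity $T$, reading each accepted article completely and skipping rejected ones; if $b=0$, run the Secretary Algorithm on the arriving articles with values $t_ih_i$, reading the selected article completely and skipping all others. *)

theory Defs
  imports "HOL-Probability.Probability" "HOL-Combinatorics.Multiset_Permutations"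
begin

text \<open>
  Instances are lists. In the random order model the order of arrival is a uniformly random
  permutation of the list positions, given as a list of positions, and it is independent of the
  random choices of the algorithm.
\<close>

definition arrival_order :: "nat \<Rightarrow> nat list pmf" where
  "arrival_order n = pmf_of_set (permutations_of_set {..<n})"

definition arrive :: "'a list \<Rightarrow> nat list \<Rightarrow> 'a list" where
  "arrive I \<pi> = map ((!) I) \<pi>"

type_synonym item = "real \<times> real"

abbreviation item_value :: "item \<Rightarrow> real" where "item_value \<equiv> fst"
abbreviation item_weight :: "item \<Rightarrow> real" where "item_weight \<equiv> snd"

definition knapsack_instance :: "real \<Rightarrow> item list \<Rightarrow> bool" where
  "knapsack_instance W I \<longleftrightarrow> W > 0 \<and> (\<forall>x\<in>set I. item_value x > 0 \<and> item_weight x > 0)"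

definition knapsack_opt :: "real \<Rightarrow> item list \<Rightarrow> real" where
  "knapsack_opt W I =
     Max {(\<Sum>i\<in>S. item_value (I ! i)) | S.
            S \<subseteq> {..<length I} \<and> (\<Sum>i\<in>S. item_weight (I ! i)) \<le> W}"

text \<open>
  An online algorithm knows the number \<open>n\<close> of items and the capacity \<open>W\<close>. It draws a seed from an
  arbitrary probability space, and decides on the current item from the seed and the list of the
  items that have arrived so far, the current one being the last. Its own earlier decisions are
  determined by these data.
\<close>

record 's knapsack_alg =
  kseeds :: "nat \<Rightarrow> real \<Rightarrow> 's measure"
  accepts :: "nat \<Rightarrow> real \<Rightarrow> 's \<Rightarrow> item list \<Rightarrow> bool"

definition accepted :: "'s knapsack_alg \<Rightarrow> real \<Rightarrow> 's \<Rightarrow> item list \<Rightarrow> nat set" where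
  "accepted A W \<omega> xs = {k. k < length xs \<and> accepts A (length xs) W \<omega> (take (Suc k) xs)}"

definition knapsack_algorithm :: "'s knapsack_alg \<Rightarrow> bool" where
  "knapsack_algorithm A \<longleftrightarrow>
     (\<forall>n W. prob_space (kseeds A n W)) \<and>
     (\<forall>n W xs. Measurable.pred (kseeds A n W) (\<lambda>\<omega>. accepts A n W \<omega> xs)) \<and>
     (\<forall>W xs. knapsack_instance W xs \<longrightarrow>
        (\<forall>\<omega>\<in>space (kseeds A (length xs) W).
           (\<Sum>k\<in>accepted A W \<omega> xs. item_weight (xs ! k)) \<le> W))"

definition knapsack_expected :: "'s knapsack_alg \<Rightarrow> real \<Rightarrow> item list \<Rightarrow> real" where
  "knapsack_expected A W I =
     measure_pmf.expectation (arrival_order (length I))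
       (\<lambda>\<pi>. LINT \<omega>|kseeds A (length I) W.
          (\<Sum>k\<in>accepted A W \<omega> (arrive I \<pi>). item_value (arrive I \<pi> ! k)))"

definition knapsack_competitive :: "real \<Rightarrow> 's knapsack_alg \<Rightarrow> bool" where
  "knapsack_competitive \<alpha> A \<longleftrightarrow> knapsack_algorithm A \<and>
     (\<forall>W I. knapsack_instance W I \<longrightarrow> knapsack_expected A W I \<ge> knapsack_opt W I / \<alpha>)"

text \<open>The information rate of an article is only relevant at the time steps \<open>1, \<dots>, len\<close>.\<close>

record article =
  hint :: nat
  len :: nat
  rate :: "nat \<Rightarrow> nat"

definition rao_instance :: "nat \<Rightarrow> article list \<Rightarrow> bool" where
  "rao_instance T I \<longleftrightarrow> T > 0 \<and>
     (\<forall>a\<in>set I. hint a > 0 \<and> len a > 0 \<and> len a \<le> T \<and> rate a \<in> {1..len a} \<rightarrow> {1..hint a}) \<and>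
     distinct (map hint I) \<and> distinct (map (\<lambda>a. len a * hint a) I)"

definition hint_accuracy :: "article list \<Rightarrow> real" where
  "hint_accuracy I =
     (LEAST C. C \<ge> 1 \<and>
        (\<forall>a\<in>set I. real (hint a) \<le> C * (\<Sum>j = 1..len a. real (rate a j)) / real (len a)))"

definition information :: "article list \<Rightarrow> (nat \<Rightarrow> nat) \<Rightarrow> nat" where
  "information I \<tau> = (\<Sum>i<length I. \<Sum>j = 1..\<tau> i. rate (I ! i) j)"

definition rao_opt :: "nat \<Rightarrow> article list \<Rightarrow> nat" where
  "rao_opt T I =
     Max {information I \<tau> | \<tau>.
            (\<forall>i<length I. \<tau> i \<le> len (I ! i)) \<and> (\<Sum>i<length I. \<tau> i) \<le> T}"

text \<open>
  An online algorithm knows the number \<open>n\<close> of articles and the time budget \<open>T\<close>, and draws a seed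
  from a probability space. It decides whether to read the next time step of the current article
  from the seed, the observations made on the previous articles (hint, length, and the rates of the
  time steps that were read), the hint and length of the current article, and the rates of the time
  steps of the current article that were read so far. Not reading the first time step is skipping.
\<close>

type_synonym observation = "(nat \<times> nat) \<times> nat list"

record 's rao_alg =
  rseeds :: "nat \<Rightarrow> nat \<Rightarrow> 's measure"
  reads_next :: "nat \<Rightarrow> nat \<Rightarrow> 's \<Rightarrow> observation list \<Rightarrow> nat \<times> nat \<Rightarrow> nat list \<Rightarrow> bool"

definition observe :: "article \<Rightarrow> nat \<Rightarrow> observation" where
  "observe a \<tau> = ((hint a, len a), map (rate a) [1..<Suc \<tau>])"

definition steps_read ::
  "(observation list \<Rightarrow> nat \<times> nat \<Rightarrow> nat list \<Rightarrow> bool) \<Rightarrow> observation list \<Rightarrow> article \<Rightarrow> nat" where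
  "steps_read p past a = (LEAST j. j = len a \<or> \<not> p past (hint a, len a) (snd (observe a j)))"

fun read_run ::
  "(observation list \<Rightarrow> nat \<times> nat \<Rightarrow> nat list \<Rightarrow> bool) \<Rightarrow> observation list \<Rightarrow> article list \<Rightarrow> nat list"
where
  "read_run p past [] = []"
| "read_run p past (a # as) =
     (let \<tau> = steps_read p past a in \<tau> # read_run p (past @ [observe a \<tau>]) as)"

definition rao_run :: "'s rao_alg \<Rightarrow> nat \<Rightarrow> 's \<Rightarrow> article list \<Rightarrow> nat list" where
  "rao_run A T \<omega> as = read_run (reads_next A (length as) T \<omega>) [] as"

definition rao_algorithm :: "'s rao_alg \<Rightarrow> bool" where
  "rao_algorithm A \<longleftrightarrow>
     (\<forall>n T. prob_space (rseeds A n T)) \<and>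
     (\<forall>n T past cur rs. Measurable.pred (rseeds A n T) (\<lambda>\<omega>. reads_next A n T \<omega> past cur rs)) \<and>
     (\<forall>T as. rao_instance T as \<longrightarrow>
        (\<forall>\<omega>\<in>space (rseeds A (length as) T). sum_list (rao_run A T \<omega> as) \<le> T))"

definition rao_expected :: "'s rao_alg \<Rightarrow> nat \<Rightarrow> article list \<Rightarrow> real" where
  "rao_expected A T I =
     measure_pmf.expectation (arrival_order (length I))
       (\<lambda>\<pi>. LINT \<omega>|rseeds A (length I) T.
          real (information (arrive I \<pi>) ((!) (rao_run A T \<omega> (arrive I \<pi>)))))"

text \<open>In both definitions \<open>vs\<close> lists the values seen so far, the current one being the last.\<close>

definition secretary_candidate :: "nat \<Rightarrow> real list \<Rightarrow> bool" where
  "secretary_candidate n vs \<longleftrightarrow>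
     length vs > nat \<lfloor>real n / exp 1\<rfloor> \<and> (\<forall>v\<in>set (butlast vs). v < last vs)"

definition secretary_selects :: "nat \<Rightarrow> real list \<Rightarrow> bool" where
  "secretary_selects n vs \<longleftrightarrow>
     secretary_candidate n vs \<and> (\<forall>k<length vs. \<not> secretary_candidate n (take k vs))"

definition article_item :: "nat \<times> nat \<Rightarrow> item" where
  "article_item = (\<lambda>(h, t). (real t * real h, real t))"

text \<open>
  The decision ignores the rates, so the answer is the same at every time step of an article:
  an article is either read completely or skipped.
\<close>

definition reduction :: "real \<Rightarrow> 's knapsack_alg \<Rightarrow> ('s \<times> bool) rao_alg" where
  "reduction \<alpha> A =
     \<lparr>rseeds = (\<lambda>n T. kseeds A n (real T) \<Otimes>\<^sub>M measure_pmf (bernoulli_pmf (\<alpha> / (exp 1 + \<alpha>)))),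
      reads_next = (\<lambda>n T (\<omega>, b) past cur _.
        let seen = map article_item (map fst past @ [cur])
        in if b then accepts A n (real T) \<omega> seen
           else secretary_selects n (map item_value seen))\<rparr>"

end

theory Submission imports Defs begin

text \<open>
  Reading an article step by step is at most as good as packing it fractionally with density \<open>h\<^sub>i\<close>,
  and an optimal fractional packing consists of an integral packing and a part of a single break
  item. Hence the optimum is at most the knapsack optimum plus the largest value \<open>t\<^sub>i h\<^sub>i\<close>. The coin
  pays for the former through the knapsack algorithm and for the latter through the Secretary
  Algorithm, both with the same factor \<open>\<delta> / \<alpha> = (1 - \<delta>) / e = 1 / (e + \<alpha>)\<close>. Reading an article
  completely yields at least \<open>t\<^sub>i h\<^sub>i / C\<close>.

  The Secretary Algorithm succeeds at position \<open>k \<ge> r = \<lfloor>n/e\<rfloor>\<close> (counted from \<open>0\<close>) if the best item is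
  at \<open>k\<close> and the best of the first \<open>k\<close> items is among the first \<open>r\<close>, an event of probability
  \<open>r / (k n)\<close>; the sum over \<open>k\<close> is at least \<open>1/e\<close> for every \<open>n\<close>, not only in the limit.
\<close>

subsection \<open>The success probability of the Secretary Algorithm\<close>

text \<open>Exchanging two entries is an involution of \<open>permutations_of_set A\<close>, so
  mapping \<open>P\<close> into \<open>Q\<close> and back already gives a bijection. The equal class
  sizes in the next two lemmas come from it.\<close>

lemma card_permutations_of_set_swap:
  assumes "i < card A" "j < card A"
    and "\<And>\<pi>. \<pi> \<in> permutations_of_set A \<Longrightarrow> P \<pi> \<Longrightarrow> Q (\<pi>[i := \<pi> ! j, j := \<pi> ! i])"
    and "\<And>\<pi>. \<pi> \<in> permutations_of_set A \<Longrightarrow> Q \<pi> \<Longrightarrow> P (\<pi>[i := \<pi> ! j, j := \<pi> ! i])"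
  shows "card {\<pi> \<in> permutations_of_set A. P \<pi>} = card {\<pi> \<in> permutations_of_set A. Q \<pi>}"
proof -
  let ?s = "\<lambda>\<pi>. \<pi>[i := \<pi> ! j, j := \<pi> ! i]"
  have len: "length \<pi> = card A" if "\<pi> \<in> permutations_of_set A" for \<pi>
    using that by (rule length_finite_permutations_of_set)
  have perm: "?s \<pi> \<in> permutations_of_set A" if "\<pi> \<in> permutations_of_set A" for \<pi>
    using that len[OF that] assms(1,2)
    by (auto intro!: permutations_of_setI simp: set_swap distinct_swap dest: permutations_of_setD)
  have inv: "?s (?s \<pi>) = \<pi>" if "\<pi> \<in> permutations_of_set A" for \<pi>
    using len[OF that] assms(1,2) by (intro nth_equalityI) (auto simp: nth_list_update)
  have "bij_betw ?s {\<pi> \<in> permutations_of_set A. P \<pi>} {\<pi> \<in> permutations_of_set A. Q \<pi>}"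
    by (rule bij_betw_byWitness[where f' = ?s]) (auto simp: inv intro: perm assms)
  then show ?thesis by (rule bij_betw_same_card)
qed

text \<open>Swapping positions shows that \<open>a\<close> is equally often at each position, and
  these \<open>n\<close> disjoint classes make up all \<open>fact n\<close> orders.\<close>

lemma card_permutations_of_set_nth_eq:
  assumes "finite A" "a \<in> A" "k < card A"
  shows "card {\<pi> \<in> permutations_of_set A. \<pi> ! k = a} = fact (card A - 1)"
proof -
  define n where "n = card A"
  let ?F = "\<lambda>k. {\<pi> \<in> permutations_of_set A. \<pi> ! k = a}"
  have same: "card (?F j) = card (?F k)" if "j < n" for j
    by (rule card_permutations_of_set_swap[of j _ k])
      (use that assms in \<open>auto simp: n_def nth_list_update length_finite_permutations_of_set\<close>)
  have cover: "permutations_of_set A = (\<Union>j<n. ?F j)"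
  proof -
    have "\<exists>j<n. \<pi> ! j = a" if "\<pi> \<in> permutations_of_set A" for \<pi>
      using permutations_of_setD[OF that] length_finite_permutations_of_set[OF that] assms(2)
      by (metis in_set_conv_nth n_def)
    then show ?thesis by auto
  qed
  have disj: "?F i \<inter> ?F j = {}" if "i < n" "j < n" "i \<noteq> j" for i j
  proof -
    have "\<pi> ! i \<noteq> \<pi> ! j" if "\<pi> \<in> permutations_of_set A" for \<pi>
      using permutations_of_setD[OF that] length_finite_permutations_of_set[OF that]
        \<open>i < n\<close> \<open>j < n\<close> \<open>i \<noteq> j\<close> by (simp add: n_def nth_eq_iff_index_eq)
    then show ?thesis by (auto, metis)
  qed
  have "fact n = card (permutations_of_set A)"
    using assms by (simp add: n_def)
  also have "\<dots> = (\<Sum>j<n. card (?F j))"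
    by (subst cover, rule card_UN_disjoint) (use disj in auto)
  also have "\<dots> = (\<Sum>j<n. card (?F k))" by (rule sum.cong) (auto simp: same)
  finally have "fact n = n * card (?F k)" by simp
  moreover have "(fact n :: nat) = n * fact (n - 1)"
    using fact_reduce[of n, where 'a = nat] assms(3) by (simp add: n_def)
  ultimately show ?thesis using assms(3) by (simp add: n_def)
qed

text \<open>Swapping two of the first \<open>k\<close> entries shows that the maximum is equally likely to be in each of them.\<close>

lemma card_permutations_of_set_prefix_max:
  fixes v :: "'a \<Rightarrow> 'b :: linorder"
  assumes "finite A" "inj_on v A" "a \<in> A" "0 < k" "r \<le> k" "k < card A"
  shows "k * card {\<pi> \<in> permutations_of_set A.
      \<pi> ! k = a \<and> (\<exists>j<r. \<forall>i<k. v (\<pi> ! i) \<le> v (\<pi> ! j))} = r * fact (card A - 1)"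
proof -
  define n where "n = card A"
  define E where "E = (\<lambda>j. {\<pi> \<in> permutations_of_set A. \<pi> ! k = a \<and> (\<forall>i<k. v (\<pi> ! i) \<le> v (\<pi> ! j))})"
  have same: "card (E i) = card (E j)" if "i < k" "j < k" for i j
    unfolding E_def
    by (rule card_permutations_of_set_swap[of i _ j])
      (use that assms in \<open>auto simp: nth_list_update length_finite_permutations_of_set\<close>)
  have cover: "{\<pi> \<in> permutations_of_set A. \<pi> ! k = a} = (\<Union>i<k. E i)"
  proof -
    have "\<exists>i<k. \<forall>i'<k. v (\<pi> ! i') \<le> v (\<pi> ! i)" for \<pi>
    proof -
      have "Max ((\<lambda>i. v (\<pi> ! i)) ` {..<k}) \<in> (\<lambda>i. v (\<pi> ! i)) ` {..<k}"
        using assms(4) by (intro Max_in) auto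
      then obtain i where "i < k" "Max ((\<lambda>i. v (\<pi> ! i)) ` {..<k}) = v (\<pi> ! i)" by auto
      then show ?thesis by (metis Max_ge finite_imageI finite_lessThan imageI lessThan_iff)
    qed
    then show ?thesis by (auto simp: E_def)
  qed
  have disj: "E i \<inter> E i' = {}" if "i < k" "i' < k" "i \<noteq> i'" for i i'
  proof -
    have False if p: "\<pi> \<in> E i" "\<pi> \<in> E i'" for \<pi>
    proof -
      have pi: "\<pi> \<in> permutations_of_set A" using p by (auto simp: E_def)
      note permutations_of_setD[OF pi] length_finite_permutations_of_set[OF pi]
      moreover from this have "\<pi> ! i \<in> A" "\<pi> ! i' \<in> A"
        using nth_mem[of i \<pi>] nth_mem[of i' \<pi>] \<open>i < k\<close> \<open>i' < k\<close> assms(6) by auto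
      moreover have "v (\<pi> ! i) = v (\<pi> ! i')"
        using p \<open>i < k\<close> \<open>i' < k\<close> by (intro antisym) (auto simp: E_def)
      ultimately show False using assms(2,6) \<open>i < k\<close> \<open>i' < k\<close> \<open>i \<noteq> i'\<close>
        by (simp add: inj_on_eq_iff nth_eq_iff_index_eq)
    qed
    then show ?thesis by blast
  qed
  have "fact (n - 1) = card {\<pi> \<in> permutations_of_set A. \<pi> ! k = a}"
    using assms by (simp add: n_def card_permutations_of_set_nth_eq)
  also have "\<dots> = (\<Sum>i<k. card (E i))"
    by (subst cover, rule card_UN_disjoint) (use disj in \<open>auto simp: E_def\<close>)
  also have "\<dots> = (\<Sum>i<k. card (E 0))" using assms(4) by (intro sum.cong same) auto
  finally have E0: "k * card (E 0) = fact (n - 1)" by simp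
  \<comment> \<open>The event in question consists of \<open>r\<close> of the \<open>k\<close>
    equally large classes, which are disjoint because \<open>v\<close> is injective. Keeping the
    factor \<open>k\<close> avoids division on the naturals.\<close>
  have "card (\<Union>i<r. E i) = (\<Sum>i<r. card (E i))"
    by (rule card_UN_disjoint) (use disj assms(5) in \<open>auto simp: E_def\<close>)
  also have "\<dots> = (\<Sum>i<r. card (E 0))" using assms(4,5) by (intro sum.cong same) auto
  finally have "k * card (\<Union>i<r. E i) = r * fact (n - 1)" using E0 by simp
  also have "(\<Union>i<r. E i) = {\<pi> \<in> permutations_of_set A.
      \<pi> ! k = a \<and> (\<exists>j<r. \<forall>i<k. v (\<pi> ! i) \<le> v (\<pi> ! j))}"
    by (auto simp: E_def)
  finally show ?thesis by (simp add: n_def)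
qed

section \<open>A non-asymptotic lower bound for the harmonic sum of the secretary problem\<close>

text \<open>The trapezoid rule overestimates the integral of the convex function \<open>1/x\<close>
  on each \<open>[k, k+1]\<close>. Summing the trapezoids leaves the correction
  \<open>(1/r - 1/n) / 2\<close>, which later absorbs the rounding of \<open>n/e\<close>.\<close>

lemma sum_inverse_ge_ln:
  assumes "0 < r" "r \<le> n"
  shows "(\<Sum>k=r..<n. 1 / real k) \<ge> ln (real n / real r) + (1 / real r - 1 / real n) / 2"
  using assms(2)
proof (induction n rule: dec_induct)
  case base
  then show ?case using assms(1) by simp
next
  case (step n)
  \<comment> \<open>\<open>L'\<close>, \<open>L\<close>, \<open>R\<close> stand for the logarithms
    of \<open>n + 1\<close>, \<open>n\<close>, \<open>r\<close>, and \<open>q\<close>,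
    \<open>p\<close>, \<open>t\<close> for the reciprocals of the same numbers; \<open>S\<close> is
    the sum up to \<open>n\<close>.\<close>
  have arith: "L' - R + (t - q) / 2 \<le> S + p"
    if "L' - L \<le> (p + q) / 2" "L - R + (t - p) / 2 \<le> S" for L L' R S p q t :: real
    using that by (simp add: field_simps)
  have n: "real n > 0" using step assms by simp
  have "ln (real (Suc n)) - ln (real n) \<le> (1 / real n + 1 / real (Suc n)) / 2"
    using ln_inverse_approx_le[OF n zero_less_one] by (simp add: inverse_eq_divide add.commute)
  moreover have "ln (real (Suc n) / real r) = ln (real (Suc n)) - ln (real r)"
    "ln (real n / real r) = ln (real n) - ln (real r)"
    using n assms(1) by (simp_all add: ln_div)
  moreover have "(\<Sum>k=r..<Suc n. 1 / real k) = (\<Sum>k=r..<n. 1 / real k) + 1 / real n"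
    using step.hyps by simp
  ultimately show ?case using step.IH by (simp only: arith)
qed

lemma exp_1_bounds: "27 / 10 < exp (1::real)" "exp (1::real) < 272 / 100"
  using abs_le_D2[OF e_approx_32] e_less_272 by auto

text \<open>With \<open>x = r/n\<close> the right-hand side is about \<open>- x * ln x\<close>,
  whose maximum \<open>1/e\<close> lies at \<open>x = 1/e\<close>. Rounding moves \<open>x\<close>
  by at most \<open>1/n\<close> and costs only second order in \<open>1/n\<close>, which the
  first-order trapezoid correction covers for large \<open>n\<close>.\<close>

lemma secretary_probability:
  fixes n :: nat
  defines "r \<equiv> nat \<lfloor>real n / exp 1\<rfloor>"
  assumes "0 < r"
  shows "1 / exp 1 \<le> real r / real n * (\<Sum>k=r..<n. 1 / real k)"
proof -
  define e :: real where "e = exp 1"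
  have e: "27 / 10 < e" "e < 272 / 100" using exp_1_bounds by (auto simp: e_def)
  have "real r \<le> real n / e" "real n / e < real r + 1"
    using floor_correct[of "real n / e"] by (simp_all add: r_def e_def)
  then have r: "real r * e \<le> real n" "real n < (real r + 1) * e"
    using e by (auto simp: field_simps)
  have "r \<le> n"
  proof -
    have "real r * 1 \<le> real r * e" using e by (intro mult_left_mono) auto
    then show ?thesis using r by simp
  qed
  have n: "0 < real n" using assms(2) \<open>r \<le> n\<close> by simp
  have e1: "1 / e \<le> 10 / 27" using e by (simp add: field_simps)
  \<comment> \<open>The trapezoid estimate of the harmonic sum suffices only for \<open>n \<ge> 9\<close>.\<close>
  show ?thesis
  proof (cases "n \<le> 8")
    case True
    \<comment> \<open>The bounds on \<open>e\<close> together with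
      \<open>r * e \<le> n < (r + 1) * e\<close> leave only \<open>n = 3, ..., 8\<close>, which are
      checked against \<open>1/e \<le> 10/27\<close>.\<close>
    have "r < 3"
    proof (rule ccontr)
      assume "\<not> r < 3"
      then have "3 * (27/10) \<le> real r * e" using e by (intro mult_mono) auto
      then show False using r True by simp
    qed
    then consider "r = 1" | "r = 2" using assms(2) by linarith
    then show ?thesis
    proof cases
      case 1
      then have "real n < 6" "2 < real n" using r e by auto
      then have "n = 3 \<or> n = 4 \<or> n = 5" by auto
      moreover have "{1..<3::nat} = {1, 2}" "{1..<4::nat} = {1, 2, 3}" "{1..<5::nat} = {1, 2, 3, 4}"
        by auto
      ultimately show ?thesis using 1 e1 unfolding e_def[symmetric] by auto
    next
      case 2
      then have "5 < real n" using r e by auto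
      then have "n = 6 \<or> n = 7 \<or> n = 8" using True by auto
      moreover have "{2..<6::nat} = {2, 3, 4, 5}" "{2..<7::nat} = {2, 3, 4, 5, 6}"
        "{2..<8::nat} = {2, 3, 4, 5, 6, 7}"
        by auto
      ultimately show ?thesis using 2 e1 unfolding e_def[symmetric] by auto
    qed
  next
    case False
    then have n9: "9 \<le> real n" by simp
    define x where "x = real r / real n"
    define d where "d = 1 / e - x"
    have x: "0 < x" "x \<le> 1 / e" using assms(2) n r e by (auto simp: x_def field_simps)
    have "real n / e / real n \<le> (real r + 1) / real n"
      using r e by (intro divide_right_mono) (auto simp: field_simps)
    then have d: "0 \<le> d" "d \<le> 1 / real n"
      using x n by (auto simp: d_def x_def add_divide_distrib)
    \<comment> \<open>This tangent bound is tight at the ideal ratio \<open>x = 1/e\<close>.\<close>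
    have "ln (e * x) \<le> e * x - 1" using x e by (intro ln_le_minus_one) auto
    moreover have "ln (e * x) = 1 + ln x" using x e by (simp add: ln_mult e_def)
    ultimately have "2 - e * x \<le> - ln x" by simp
    then have le: "2 - e * x \<le> ln (real n / real r)"
      using assms(2) n by (simp add: x_def ln_div)
    then have "x * (2 - e * x) + x * (1 / real r - 1 / real n) / 2
        \<le> x * (ln (real n / real r) + (1 / real r - 1 / real n) / 2)"
      using mult_left_mono[OF le, of x] x by (simp add: distrib_left)
    also have "\<dots> \<le> x * (\<Sum>k=r..<n. 1 / real k)"
      using x assms(2) \<open>r \<le> n\<close> by (intro mult_left_mono sum_inverse_ge_ln) auto
    finally have main: "x * (2 - e * x) + x * (1 / real r - 1 / real n) / 2 \<le> x * (\<Sum>k=r..<n. 1 / real k)" .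
    \<comment> \<open>No term linear in \<open>d\<close> survives, because \<open>1/e\<close>
      maximises the parabola \<open>x * (2 - e * x)\<close>.\<close>
    have A: "x * (2 - e * x) = 1 / e - e * d\<^sup>2"
      using e by (simp add: d_def power2_eq_square field_simps)
    have B: "x * (1 / real r - 1 / real n) = (1 - x) / real n"
      using assms(2) n by (simp add: x_def field_simps)
    have "e * d\<^sup>2 \<le> e * (1 / real n)\<^sup>2" using d e by (intro mult_left_mono power_mono) auto
    also have "\<dots> = e / real n / real n" by (simp add: power2_eq_square)
    also have "\<dots> \<le> (1 - x) / 2 / real n"
    proof (rule divide_right_mono)
      \<comment> \<open>The threshold \<open>9\<close> enters here:
        \<open>2.72 / 9 < (1 - 10/27) / 2\<close>, which would fail with \<open>8\<close>.\<close>
      have "e / real n \<le> (272/100) / 9" using e n9 by (intro frac_le) auto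
      moreover have "x \<le> 10/27" using x e1 by linarith
      ultimately show "e / real n \<le> (1 - x) / 2" by simp
    qed simp
    finally have "1 / e \<le> x * (\<Sum>k=r..<n. 1 / real k)" using main A B by simp
    then show ?thesis by (simp add: x_def e_def)
  qed
qed

section \<open>From counting orders to the expected gain of the Secretary Algorithm\<close>

text \<open>The best of the first \<open>k\<close> entries lies in the observation phase, so no
  entry before \<open>k\<close> beats all its predecessors after that phase, and the first candidate
  is at \<open>k\<close>.\<close>

lemma secretary_selects_take:
  assumes "j < nat \<lfloor>real n / exp 1\<rfloor>" "nat \<lfloor>real n / exp 1\<rfloor> \<le> k" "k < length vs"
    and "\<And>i. i < k \<Longrightarrow> vs ! i \<le> vs ! j" "vs ! j < vs ! k"
  shows "secretary_selects n (take (Suc k) vs)"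
proof -
  have last: "last (take (Suc m) vs) = vs ! m" "butlast (take (Suc m) vs) = take m vs" if "m \<le> k" for m
    using that assms(3) by (simp_all add: take_Suc_conv_app_nth)
  have "v < vs ! k" if "v \<in> set (take k vs)" for v
    using that assms(3) less_le_trans assms(4,5) by (force simp: in_set_conv_nth)
  then have "secretary_candidate n (take (Suc k) vs)"
    using assms(2,3) last[of k] by (simp add: secretary_candidate_def)
  moreover have "\<not> secretary_candidate n (take m vs)" if "m < Suc k" for m
  proof
    assume cand: "secretary_candidate n (take m vs)"
    then obtain m' where m: "m = Suc m'" "j < m'"
      using assms(1) that by (cases m) (auto simp: secretary_candidate_def)
    then have "vs ! j \<in> set (take m' vs)"
      using that assms(3) by (auto simp: in_set_conv_nth)
    then have "vs ! j < vs ! m'"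
      using cand last[of m'] m that by (simp add: secretary_candidate_def)
    then show False using assms(4)[of m'] m that by simp
  qed
  ultimately show ?thesis
    using assms(3) by (auto simp: secretary_selects_def min_def)
qed

lemma secretary_selects_Cons_Nil:
  assumes "nat \<lfloor>real n / exp 1\<rfloor> = 0"
  shows "secretary_selects n [v]"
  using assms by (simp add: secretary_selects_def secretary_candidate_def)

text \<open>For each position \<open>k\<close> after the observation phase, the prefix-maximum event
  forces the selection of the best item at \<open>k\<close>. Its count
  \<open>r / k * fact (n - 1)\<close> is then summed over \<open>k\<close>.\<close>

lemma secretary_success:
  fixes v :: "'a \<Rightarrow> real"
  assumes "finite A" "inj_on v A" "a \<in> A" "\<And>x. x \<in> A \<Longrightarrow> v x \<le> v a"
  defines "n \<equiv> card A"
  shows "fact n / exp 1 \<le> (\<Sum>k<n. real (card {\<pi> \<in> permutations_of_set A.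
    \<pi> ! k = a \<and> secretary_selects n (take (Suc k) (map v \<pi>))}))"
proof -
  let ?S = "\<lambda>k. {\<pi> \<in> permutations_of_set A. \<pi> ! k = a \<and> secretary_selects n (take (Suc k) (map v \<pi>))}"
  define r where "r = nat \<lfloor>real n / exp 1\<rfloor>"
  have n: "0 < n" using assms by (auto simp: card_gt_0_iff)
  then have fact_n: "(fact n :: real) = real n * fact (n - 1)" by (rule fact_reduce)
  have len: "length \<pi> = n" if "\<pi> \<in> permutations_of_set A" for \<pi>
    using length_finite_permutations_of_set[OF that] by (simp add: n_def)
  show ?thesis
  proof (cases "r = 0")
    \<comment> \<open>Without an observation phase the first item is selected; it is the best one in
      \<open>fact (n - 1)\<close> orders, which suffices because \<open>n / e < 1\<close>.\<close>
    case True
    have "?S 0 = {\<pi> \<in> permutations_of_set A. \<pi> ! 0 = a}"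
    proof -
      have "take (Suc 0) (map v \<pi>) = [v (\<pi> ! 0)]" if "\<pi> \<in> permutations_of_set A" for \<pi>
        using len[OF that] n by (cases \<pi>) auto
      then show ?thesis
        using secretary_selects_Cons_Nil[of n] True by (auto simp: r_def)
    qed
    then have S0: "real (card (?S 0)) = fact (n - 1)"
      using card_permutations_of_set_nth_eq[OF assms(1,3), of 0] n by (simp add: n_def)
    have "\<lfloor>real n / exp 1\<rfloor> < 1" using True by (simp add: r_def)
    then have "real n / exp 1 \<le> 1" by linarith
    then have "fact n / exp 1 \<le> (fact (n - 1) :: real)"
      using mult_right_mono[of "real n / exp 1" 1 "fact (n - 1)"] by (simp add: fact_n)
    also have "\<dots> \<le> (\<Sum>k<n. real (card (?S k)))"
      unfolding S0[symmetric] using n by (intro member_le_sum) auto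
    finally show ?thesis .
  next
    case False
    have S: "real r / real k * fact (n - 1) \<le> real (card (?S k))" if k: "r \<le> k" "k < n" for k
    proof -
      let ?R = "{\<pi> \<in> permutations_of_set A. \<pi> ! k = a \<and> (\<exists>j<r. \<forall>i<k. v (\<pi> ! i) \<le> v (\<pi> ! j))}"
      have "?R \<subseteq> ?S k"
      proof safe
        fix \<pi> j
        assume \<pi>: "\<pi> \<in> permutations_of_set A" "a = \<pi> ! k" "j < r" "\<forall>i<k. v (\<pi> ! i) \<le> v (\<pi> ! j)"
        note p = permutations_of_setD[OF \<pi>(1)] len[OF \<pi>(1)]
        have "\<pi> ! j \<in> A" using nth_mem[of j \<pi>] p \<pi>(3) k by simp
        moreover have "\<pi> ! j \<noteq> a"
          using p \<pi>(2,3) k by (simp add: nth_eq_iff_index_eq)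
        ultimately have "v (\<pi> ! j) < v a"
          using assms(2,3) assms(4)[of "\<pi> ! j"] inj_on_eq_iff[of v A "\<pi> ! j" a] by simp
        then show "secretary_selects n (take (Suc k) (map v \<pi>))"
          using \<pi> p k by (intro secretary_selects_take[of j]) (auto simp: r_def)
      qed
      then have "card ?R \<le> card (?S k)" by (intro card_mono) auto
      moreover have "k * card ?R = r * fact (n - 1)"
        using card_permutations_of_set_prefix_max[OF assms(1-3), of k r] k False by (simp add: n_def)
      then have "real k * real (card ?R) = real r * fact (n - 1)"
        by (auto dest: arg_cong[where f = real])
      ultimately have "real r * fact (n - 1) \<le> real k * real (card (?S k))"
        using mult_left_mono[of "real (card ?R)" "real (card (?S k))" "real k"] by simp
      then show ?thesis using k False by (simp add: field_simps)
    qed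
    have "fact n / exp 1 \<le> fact n * (real r / real n * (\<Sum>k=r..<n. 1 / real k))"
      using mult_left_mono[OF secretary_probability[of n], of "fact n"] False by (simp add: r_def)
    also have "\<dots> = (\<Sum>k=r..<n. real r / real k * fact (n - 1))"
      using n by (simp add: fact_n sum_distrib_left sum_distrib_right mult_ac)
    also have "\<dots> \<le> (\<Sum>k=r..<n. real (card (?S k)))" using S by (intro sum_mono) auto
    also have "\<dots> \<le> (\<Sum>k<n. real (card (?S k)))" by (intro sum_mono2) auto
    finally show ?thesis .
  qed
qed

lemma expectation_arrival_order:
  "measure_pmf.expectation (arrival_order n) f = (\<Sum>\<pi>\<in>permutations_of_set {..<n}. f \<pi>) / fact n"
  for f :: "nat list \<Rightarrow> real"
  by (simp add: arrival_order_def integral_pmf_of_set)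

text \<open>Only the orders in which the maximum itself is selected are counted; every other
  selection contributes a nonnegative value.\<close>

lemma secretary_competitive:
  assumes "distinct vs" "v \<in> set vs" "\<And>x. x \<in> set vs \<Longrightarrow> 0 \<le> x \<and> x \<le> v"
  defines "n \<equiv> length vs"
  shows "v / exp 1 \<le> measure_pmf.expectation (arrival_order n)
    (\<lambda>\<pi>. \<Sum>k<n. if secretary_selects n (take (Suc k) (arrive vs \<pi>)) then arrive vs \<pi> ! k else 0)"
proof -
  let ?P = "permutations_of_set {..<n}"
  let ?sel = "\<lambda>k \<pi>. secretary_selects n (take (Suc k) (arrive vs \<pi>))"
  from assms(2) obtain a where a: "a < n" "vs ! a = v" by (auto simp: in_set_conv_nth n_def)
  have "inj_on ((!) vs) {..<n}" using assms(1) by (simp add: inj_on_nth n_def)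
  moreover have "vs ! i \<le> vs ! a" if "i \<in> {..<n}" for i
    using assms(3)[of "vs ! i"] that a by (simp add: n_def)
  ultimately have "fact n / exp 1 \<le> (\<Sum>k<n. real (card {\<pi> \<in> ?P. \<pi> ! k = a \<and> ?sel k \<pi>}))"
    using secretary_success[of "{..<n}" "(!) vs" a] a by (simp add: arrive_def)
  also have "\<dots> = (\<Sum>k<n. \<Sum>\<pi>\<in>?P. if \<pi> ! k = a \<and> ?sel k \<pi> then 1 else 0)"
    by (simp add: sum.If_cases Int_def)
  also have "\<dots> = (\<Sum>\<pi>\<in>?P. \<Sum>k<n. if \<pi> ! k = a \<and> ?sel k \<pi> then 1 else 0)"
    by (rule sum.swap)
  finally have "v * (fact n / exp 1) \<le> v * (\<Sum>\<pi>\<in>?P. \<Sum>k<n. if \<pi> ! k = a \<and> ?sel k \<pi> then 1 else 0)"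
    using assms(2,3) by (intro mult_left_mono) auto
  also have "\<dots> = (\<Sum>\<pi>\<in>?P. \<Sum>k<n. if \<pi> ! k = a \<and> ?sel k \<pi> then v else 0)"
    by (simp add: sum_distrib_left if_distrib cong: if_cong)
  also have "\<dots> \<le> (\<Sum>\<pi>\<in>?P. \<Sum>k<n. if ?sel k \<pi> then arrive vs \<pi> ! k else 0)"
  proof (intro sum_mono)
    fix \<pi> k assume \<pi>: "\<pi> \<in> ?P" "k \<in> {..<n}"
    then have "length \<pi> = n" using length_finite_permutations_of_set by fastforce
    moreover from this have "\<pi> ! k < n" using permutations_of_setD(1)[OF \<pi>(1)] \<pi>(2) nth_mem by blast
    ultimately show "(if \<pi> ! k = a \<and> ?sel k \<pi> then v else 0) \<le> (if ?sel k \<pi> then arrive vs \<pi> ! k else 0)"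
      using a \<pi>(2) assms(3)[of "vs ! (\<pi> ! k)"] by (auto simp: arrive_def n_def)
  qed
  finally show ?thesis
    by (simp add: expectation_arrival_order field_simps)
qed

subsection \<open>The fractional knapsack bound\<close>

text \<open>Either everything fits, or the greedy filling by density, with its break item counted in
  full, exceeds \<open>W\<close>. In the latter case an exchange argument shows that it dominates
  \<open>\<tau>\<close>.\<close>

lemma fractional_knapsack_le:
  fixes w \<tau> d :: "'a \<Rightarrow> real"
  assumes "finite N" "inj_on d N" and \<tau>: "\<And>i. i \<in> N \<Longrightarrow> 0 \<le> \<tau> i \<and> \<tau> i \<le> w i"
    and d: "\<And>i. i \<in> N \<Longrightarrow> 0 \<le> d i" and W: "(\<Sum>i\<in>N. \<tau> i) \<le> W"
  obtains S where "S \<subseteq> N" "(\<Sum>i\<in>S. w i) \<le> W" "(\<Sum>i\<in>N. \<tau> i * d i) \<le> (\<Sum>i\<in>S. w i * d i)"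
  | S s where "S \<subseteq> N" "(\<Sum>i\<in>S. w i) \<le> W" "s \<in> N"
      "(\<Sum>i\<in>N. \<tau> i * d i) \<le> (\<Sum>i\<in>S. w i * d i) + w s * d s"
proof (cases "(\<Sum>i\<in>N. w i) \<le> W")
  case True
  moreover have "(\<Sum>i\<in>N. \<tau> i * d i) \<le> (\<Sum>i\<in>N. w i * d i)"
    using \<tau> d by (intro sum_mono mult_right_mono) auto
  ultimately show ?thesis using that(1) by blast
next
  case False
  \<comment> \<open>\<open>U x\<close> collects the items of density at least \<open>x\<close>. An
    item \<open>i\<close> is in \<open>B\<close> if filling by decreasing density down to and
    including \<open>i\<close> overflows \<open>W\<close>.\<close>
  define U where "U = (\<lambda>x. {i \<in> N. x \<le> d i})"
  define B where "B = {i \<in> N. W < (\<Sum>i'\<in>U (d i). w i')}"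
  have fin: "finite B" using assms(1) by (simp add: B_def)
  have "N \<noteq> {}" using False W by auto
  then have "Min (d ` N) \<in> d ` N" using assms(1) by (intro Min_in) auto
  then obtain i where i: "i \<in> N" "Min (d ` N) = d i" by auto
  have "U (d i) = N" using assms(1) by (auto simp: U_def i(2)[symmetric])
  then have "B \<noteq> {}" using i False by (auto simp: B_def)
  then have "Max (d ` B) \<in> d ` B" using fin by (intro Max_in) auto
  \<comment> \<open>\<open>s\<close> is the break item: the denser items \<open>S\<close> fit into the capacity, but no longer together with \<open>s\<close>.\<close>
  then obtain s where s: "s \<in> B" "\<And>i. i \<in> B \<Longrightarrow> d i \<le> d s"
    using fin by (auto simp: image_iff) (metis Max_ge finite_imageI imageI)
  then have sN: "s \<in> N" by (simp add: B_def)
  define S where "S = {i \<in> N. d s < d i}"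
  have finS: "finite S" "s \<notin> S" using assms(1) by (auto simp: S_def)
  have U: "U (d s) = insert s S"
    using sN assms(2) by (auto simp: U_def S_def inj_on_eq_iff less_le)
  have S_le: "(\<Sum>i\<in>S. w i) \<le> W"
  proof (cases "S = {}")
    case True
    have "0 \<le> W" using W \<tau> sum_nonneg[of N \<tau>] by force
    then show ?thesis using True by simp
  next
    case False
    then have "Min (d ` S) \<in> d ` S" using finS by (intro Min_in) auto
    then obtain m where m: "m \<in> S" "Min (d ` S) = d m" by auto
    \<comment> \<open>\<open>m\<close> is the least dense item of \<open>S\<close>, so filling down
      to \<open>m\<close> uses exactly \<open>S\<close>. Being denser than \<open>s\<close>, it is
      outside \<open>B\<close>, hence \<open>S\<close> fits.\<close>
    have "d m \<le> d i" if "i \<in> S" for i using that finS by (simp flip: m(2))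
    then have "U (d m) = S" using m(1) by (force simp: U_def S_def)
    moreover have "m \<notin> B" using s(2)[of m] m(1) by (auto simp: S_def)
    ultimately show ?thesis using m(1) by (auto simp: B_def S_def)
  qed
  have big: "W < (\<Sum>i\<in>insert s S. w i)" using s(1) U by (simp add: B_def)
  have sub: "insert s S \<subseteq> N" using sN by (auto simp: S_def)
  let ?w = "\<lambda>i. if i \<in> insert s S then w i else 0"
  have sum_w: "(\<Sum>i\<in>N. ?w i * f i) = (\<Sum>i\<in>insert s S. w i * f i)" for f
    by (rule sum.mono_neutral_cong_right) (use assms(1) sub in auto)
  have "(\<Sum>i\<in>N. \<tau> i * d i) - (\<Sum>i\<in>N. ?w i * d i) = (\<Sum>i\<in>N. (\<tau> i - ?w i) * d i)"
    by (simp add: sum_subtractf left_diff_distrib)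
  \<comment> \<open>The factor \<open>\<tau> i - ?w i\<close> is nonpositive on
    \<open>insert s S\<close>, where \<open>d i\<close> is at least \<open>d s\<close>, and
    nonnegative elsewhere, where it is at most \<open>d s\<close>. So replacing \<open>d i\<close>
    by \<open>d s\<close> never decreases a term.\<close>
  also have "\<dots> \<le> (\<Sum>i\<in>N. (\<tau> i - ?w i) * d s)"
  proof (rule sum_mono)
    fix i assume i: "i \<in> N"
    show "(\<tau> i - ?w i) * d i \<le> (\<tau> i - ?w i) * d s"
    proof (cases "i \<in> insert s S")
      case True
      then have "d s \<le> d i" by (auto simp: S_def)
      then show ?thesis using True \<tau>[OF i] by (auto intro!: mult_left_mono_neg)
    next
      case False
      then have "d i \<le> d s" using i by (auto simp: S_def)
      then show ?thesis using False \<tau>[OF i] by (auto intro!: mult_left_mono)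
    qed
  qed
  also have "\<dots> = ((\<Sum>i\<in>N. \<tau> i) - (\<Sum>i\<in>insert s S. w i)) * d s"
    using sum_w[of "\<lambda>_. 1"] by (simp add: sum_subtractf flip: sum_distrib_right)
  also have "\<dots> \<le> 0" using big W d[OF sN] by (intro mult_nonpos_nonneg) auto
  finally have "(\<Sum>i\<in>N. \<tau> i * d i) \<le> (\<Sum>i\<in>insert s S. w i * d i)" by (simp only: sum_w diff_le_0_iff_le)
  then show ?thesis
    using that(2)[of S s] S_le sN sub finS by (simp add: add.commute)
qed

subsection \<open>Runs of the Reduction Algorithm\<close>

lemma steps_read_oblivious:
  assumes "\<And>rs. p past (hint a, len a) rs = b"
  shows "steps_read p past a = (if b then len a else 0)"
  using assms by (auto simp: steps_read_def intro: Least_equality)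

text \<open>Decisions that ignore all observed rates do not depend on how far earlier articles were
  read, so the recursion over the past unfolds into a map over positions.\<close>

lemma read_run_oblivious:
  assumes "\<And>past cur rs. p past cur rs = q (map fst past @ [cur])"
  shows "read_run p past as =
    map (\<lambda>k. if q (map fst past @ map (\<lambda>a. (hint a, len a)) (take (Suc k) as)) then len (as ! k) else 0)
      [0..<length as]"
proof (induction as arbitrary: past)
  case (Cons a as)
  have "steps_read p past a = (if q (map fst past @ [(hint a, len a)]) then len a else 0)"
    by (rule steps_read_oblivious) (simp add: assms)
  then show ?case
    by (simp add: Cons.IH Let_def observe_def map_upt_Suc del: upt_Suc)
qed simp

definition item_of :: "article \<Rightarrow> item" where
  "item_of a = article_item (hint a, len a)"

definition full_information :: "article \<Rightarrow> nat" where
  "full_information a = (\<Sum>j = 1..len a. rate a j)"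

lemma item_of_simps [simp]:
  "item_value (item_of a) = real (len a) * real (hint a)" "item_weight (item_of a) = real (len a)"
  by (simp_all add: item_of_def article_item_def)

text \<open>Closed form of the decisions, on the same prefixes of items that \<open>accepted\<close>
  uses, so that both algorithms can be compared seed by seed.\<close>

definition reduction_reads :: "'s knapsack_alg \<Rightarrow> nat \<Rightarrow> 's \<times> bool \<Rightarrow> article list \<Rightarrow> nat \<Rightarrow> bool" where
  "reduction_reads A T = (\<lambda>(\<omega>, b) as k.
     if b then accepts A (length as) (real T) \<omega> (take (Suc k) (map item_of as))
     else secretary_selects (length as) (take (Suc k) (map (item_value \<circ> item_of) as)))"

lemma rao_run_reduction:
  "rao_run (reduction \<alpha> A) T s as =
    map (\<lambda>k. if reduction_reads A T s as k then len (as ! k) else 0) [0..<length as]"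
proof -
  obtain \<omega> b where s: "s = (\<omega>, b)" by force
  define q where "q = (\<lambda>ks. let seen = map article_item ks in
    if b then accepts A (length as) (real T) \<omega> seen
    else secretary_selects (length as) (map item_value seen))"
  have run: "read_run (reads_next (reduction \<alpha> A) (length as) T s) [] as =
      map (\<lambda>k. if q (map fst ([] :: observation list) @ map (\<lambda>a. (hint a, len a)) (take (Suc k) as))
        then len (as ! k) else 0) [0..<length as]"
    by (rule read_run_oblivious) (simp add: reduction_def s q_def Let_def)
  have q: "q (map fst ([] :: observation list) @ map (\<lambda>a. (hint a, len a)) (take (Suc k) as))
      = reduction_reads A T s as k" for k
    by (simp add: q_def s reduction_reads_def take_map item_of_def[abs_def] o_def Let_def)
  show ?thesis unfolding rao_run_def run q ..
qed

lemma information_reduction: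
  "information as ((!) (rao_run (reduction \<alpha> A) T s as)) =
    (\<Sum>k<length as. if reduction_reads A T s as k then full_information (as ! k) else 0)"
  by (auto simp: information_def rao_run_reduction full_information_def intro!: sum.cong)

text \<open>A selection forbids candidates among the shorter prefixes, and an earlier selection
  would be one.\<close>

lemma secretary_selects_unique:
  assumes "secretary_selects n (take (Suc k) vs)" "secretary_selects n (take (Suc l) vs)"
    "k < length vs" "l < length vs"
  shows "k = l"
proof -
  have False if "secretary_selects n (take (Suc k) vs)" "secretary_selects n (take (Suc l) vs)"
    "k < l" "l < length vs" for k l
  proof -
    have "take (Suc k) (take (Suc l) vs) = take (Suc k) vs" using that by (simp add: min_def)
    moreover have "Suc k < length (take (Suc l) vs)" using that by simp
    ultimately show False using that(1,2) unfolding secretary_selects_def by metis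
  qed
  then show ?thesis using assms by (metis linorder_neqE_nat)
qed

lemma rao_instance_knapsack:
  assumes "rao_instance T I"
  shows "knapsack_instance (real T) (map item_of I)"
  using assms by (auto simp: rao_instance_def knapsack_instance_def)

text \<open>The budget holds for either coin: feasibility of the knapsack algorithm with weights
  \<open>len\<close>, or at most one article read, of length at most \<open>T\<close>.\<close>

lemma rao_algorithm_reduction:
  assumes "knapsack_algorithm A"
  shows "rao_algorithm (reduction \<alpha> A)"
  unfolding rao_algorithm_def
proof (intro conjI allI impI ballI)
  have A: "prob_space (kseeds A n W)" for n W
    using assms by (simp add: knapsack_algorithm_def)
  fix n T
  interpret K: prob_space "kseeds A n (real T)" by (rule A)
  interpret B: prob_space "measure_pmf (bernoulli_pmf (\<alpha> / (exp 1 + \<alpha>)))" by (rule prob_space_measure_pmf)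
  interpret P: pair_prob_space "kseeds A n (real T)" "measure_pmf (bernoulli_pmf (\<alpha> / (exp 1 + \<alpha>)))" ..
  show "prob_space (rseeds (reduction \<alpha> A) n T)"
    by (simp add: reduction_def P.prob_space_axioms)
next
  fix n T past cur and rs :: "nat list"
  have A [measurable]: "Measurable.pred (kseeds A n W) (\<lambda>\<omega>. accepts A n W \<omega> xs)" for W xs
    using assms by (simp add: knapsack_algorithm_def)
  show "Measurable.pred (rseeds (reduction \<alpha> A) n T) (\<lambda>\<omega>. reads_next (reduction \<alpha> A) n T \<omega> past cur rs)"
    by (simp add: reduction_def Let_def split_beta')
next
  fix T as s
  assume as: "rao_instance T as" and s: "s \<in> space (rseeds (reduction \<alpha> A) (length as) T)"
  obtain \<omega> b where \<omega>: "s = (\<omega>, b)" "\<omega> \<in> space (kseeds A (length as) (real T))"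
    using s by (auto simp: reduction_def space_pair_measure)
  let ?R = "{k. k < length as \<and> reduction_reads A T s as k}"
  have sum: "sum_list (rao_run (reduction \<alpha> A) T s as) = (\<Sum>k\<in>?R. len (as ! k))"
    by (simp add: rao_run_reduction interv_sum_list_conv_sum_set_nat sum.If_cases Int_def)
  show "sum_list (rao_run (reduction \<alpha> A) T s as) \<le> T"
  proof (cases b)
    case True
    then have R: "?R = accepted A (real T) \<omega> (map item_of as)"
      by (auto simp: accepted_def reduction_reads_def \<omega>)
    have "(\<Sum>k\<in>?R. item_weight (map item_of as ! k)) \<le> real T"
      using assms rao_instance_knapsack[OF as] \<omega>(2) unfolding R knapsack_algorithm_def by auto
    then have "real (\<Sum>k\<in>?R. len (as ! k)) \<le> real T" by simp
    then show ?thesis unfolding sum by linarith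
  next
    case False
    then have "k = l" if "k \<in> ?R" "l \<in> ?R" for k l
      using that secretary_selects_unique[of "length as" k "map (item_value \<circ> item_of) as" l]
      by (auto simp: reduction_reads_def \<omega>)
    then consider "?R = {}" | k where "?R = {k}" by blast
    then show ?thesis
    proof cases
      case 1
      then show ?thesis unfolding sum by (simp only: sum.empty)
    next
      case 2
      then have "k < length as" by blast
      then show ?thesis using as unfolding sum 2 by (simp add: rao_instance_def)
    qed
  qed
qed

subsection \<open>Hint accuracy and optimal values\<close>

text \<open>A \<open>LEAST\<close> over the reals need not be attained. Here the conditions are
  finitely many lower bounds on \<open>C\<close>, so it is the maximum of \<open>1\<close> and the
  ratios; positive rates keep the denominators nonzero.\<close>

lemma hint_accuracy_properties:
  assumes "rao_instance T I"
  shows "1 \<le> hint_accuracy I"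
    and "a \<in> set I \<Longrightarrow> real (len a) * real (hint a) \<le> hint_accuracy I * real (full_information a)"
proof -
  have pos: "0 < len a" "0 < full_information a" if "a \<in> set I" for a
  proof -
    show "0 < len a" using assms that by (simp add: rao_instance_def)
    moreover have "rate a \<in> {1..len a} \<rightarrow> {1..hint a}" using assms that by (simp add: rao_instance_def)
    ultimately have "rate a 1 \<in> {1..hint a}" by (intro funcset_mem[of "rate a" "{1..len a}"]) auto
    moreover have "rate a 1 \<le> full_information a"
      unfolding full_information_def using \<open>0 < len a\<close> by (intro member_le_sum) auto
    ultimately show "0 < full_information a" by simp
  qed
  let ?ratio = "\<lambda>a. real (len a) * real (hint a) / real (full_information a)"
  have iff: "real (hint a) \<le> C * (\<Sum>j = 1..len a. real (rate a j)) / real (len a) \<longleftrightarrow> ?ratio a \<le> C"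
    if "a \<in> set I" for a C
    using pos[OF that] by (simp add: full_information_def field_simps flip: of_nat_sum)
  let ?M = "Max (insert 1 (?ratio ` set I))"
  have "hint_accuracy I = (LEAST C. 1 \<le> C \<and> (\<forall>a\<in>set I. ?ratio a \<le> C))"
    unfolding hint_accuracy_def by (simp only: iff cong: ball_cong)
  also have "\<dots> = ?M" by (rule Least_equality) auto
  finally have M: "hint_accuracy I = ?M" .
  show "1 \<le> hint_accuracy I" unfolding M by (rule Max_ge) auto
  show "real (len a) * real (hint a) \<le> hint_accuracy I * real (full_information a)" if "a \<in> set I"
  proof -
    have "?ratio a \<le> hint_accuracy I" unfolding M by (rule Max_ge) (use that in auto)
    then show ?thesis using pos[OF that] by (simp add: field_simps)
  qed
qed

lemma knapsack_opt_upper: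
  assumes "S \<subseteq> {..<length I}" "(\<Sum>i\<in>S. item_weight (I ! i)) \<le> W"
  shows "(\<Sum>i\<in>S. item_value (I ! i)) \<le> knapsack_opt W I"
proof -
  have "finite ((\<lambda>S. \<Sum>i\<in>S. item_value (I ! i)) ` Pow {..<length I})" by simp
  then have "finite {(\<Sum>i\<in>S. item_value (I ! i)) | S.
      S \<subseteq> {..<length I} \<and> (\<Sum>i\<in>S. item_weight (I ! i)) \<le> W}"
    by (rule rev_finite_subset) auto
  then show ?thesis unfolding knapsack_opt_def using assms by (intro Max_ge) auto
qed

text \<open>Values of \<open>\<tau>\<close> beyond the list are unconstrained, so there are
  infinitely many \<open>\<tau>\<close>. Their information is bounded by that of reading everything,
  which makes the set under \<open>Max\<close> finite.\<close>

lemma rao_opt_attained: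
  obtains \<tau> where "rao_opt T I = information I \<tau>" "\<And>i. i < length I \<Longrightarrow> \<tau> i \<le> len (I ! i)"
    "(\<Sum>i<length I. \<tau> i) \<le> T"
proof -
  let ?X = "{information I \<tau> | \<tau>. (\<forall>i<length I. \<tau> i \<le> len (I ! i)) \<and> (\<Sum>i<length I. \<tau> i) \<le> T}"
  have "?X \<subseteq> {..\<Sum>i<length I. full_information (I ! i)}"
    by (auto simp: information_def full_information_def intro!: sum_mono sum_mono2)
  then have "finite ?X" by (rule finite_subset) simp
  moreover have "information I (\<lambda>_. 0) \<in> ?X" by auto
  ultimately have "rao_opt T I \<in> ?X" unfolding rao_opt_def by (intro Max_in) auto
  then show ?thesis using that by blast
qed

text \<open>Bounding each rate by the hint turns \<open>\<tau>\<close> into a fractional packing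
  with densities \<open>hint\<close>. Distinct hints provide the injectivity needed for the break
  item.\<close>

lemma rao_opt_le_knapsack_opt:
  assumes "rao_instance T I" "I \<noteq> []"
  obtains a where "a \<in> set I"
    "real (rao_opt T I) \<le> knapsack_opt (real T) (map item_of I) + item_value (item_of a)"
proof -
  let ?N = "{..<length I}" and ?d = "\<lambda>i. real (hint (I ! i))" and ?w = "\<lambda>i. real (len (I ! i))"
  obtain \<tau> where \<tau>: "rao_opt T I = information I \<tau>" "\<And>i. i < length I \<Longrightarrow> \<tau> i \<le> len (I ! i)"
    "(\<Sum>i<length I. \<tau> i) \<le> T"
    using rao_opt_attained[of T I] by blast
  have "(\<Sum>j = 1..\<tau> i. rate (I ! i) j) \<le> \<tau> i * hint (I ! i)" if "i < length I" for i
  proof -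
    have "rate (I ! i) j \<le> hint (I ! i)" if "j \<in> {1..\<tau> i}" for j
      using assms(1) \<tau>(2)[OF \<open>i < length I\<close>] that \<open>i < length I\<close>
      by (fastforce simp: rao_instance_def Pi_def)
    then show ?thesis using sum_bounded_above[of "{1..\<tau> i}" "rate (I ! i)" "hint (I ! i)"] by simp
  qed
  then have "information I \<tau> \<le> (\<Sum>i<length I. \<tau> i * hint (I ! i))"
    unfolding information_def by (intro sum_mono) auto
  then have opt: "real (rao_opt T I) \<le> (\<Sum>i\<in>?N. real (\<tau> i) * ?d i)"
    unfolding \<tau>(1) by (simp flip: of_nat_mult of_nat_sum)
  have inj: "inj_on ?d ?N"
    using assms(1) by (auto simp: rao_instance_def inj_on_def distinct_conv_nth)
  have bound: "(\<Sum>i\<in>S. ?w i * ?d i) \<le> knapsack_opt (real T) (map item_of I)"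
    if "S \<subseteq> ?N" "(\<Sum>i\<in>S. ?w i) \<le> real T" for S
  proof -
    have "(\<Sum>i\<in>S. item_weight (map item_of I ! i)) = (\<Sum>i\<in>S. ?w i)"
      "(\<Sum>i\<in>S. item_value (map item_of I ! i)) = (\<Sum>i\<in>S. ?w i * ?d i)"
      using that(1) by (auto intro!: sum.cong)
    then show ?thesis using knapsack_opt_upper[of S "map item_of I" "real T"] that by simp
  qed
  have budget: "(\<Sum>i\<in>?N. real (\<tau> i)) \<le> real T" using \<tau>(3) by (simp flip: of_nat_sum)
  show thesis
  proof (rule fractional_knapsack_le[of ?N ?d "\<lambda>i. real (\<tau> i)" ?w "real T"])
    fix S assume S: "S \<subseteq> ?N" "(\<Sum>i\<in>S. ?w i) \<le> real T"
      "(\<Sum>i\<in>?N. real (\<tau> i) * ?d i) \<le> (\<Sum>i\<in>S. ?w i * ?d i)"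
    \<comment> \<open>There is no break item here; any article serves as \<open>a\<close>, since its
      value is nonnegative.\<close>
    have "hd I \<in> set I" using assms(2) by simp
    moreover have "0 \<le> item_value (item_of (hd I))" by simp
    ultimately show thesis using that[of "hd I"] bound[OF S(1,2)] S(3) opt by linarith
  next
    fix S s assume S: "S \<subseteq> ?N" "(\<Sum>i\<in>S. ?w i) \<le> real T" "s \<in> ?N"
      "(\<Sum>i\<in>?N. real (\<tau> i) * ?d i) \<le> (\<Sum>i\<in>S. ?w i * ?d i) + ?w s * ?d s"
    then have "I ! s \<in> set I" by simp
    then show thesis using that[of "I ! s"] bound[OF S(1,2)] S(4) opt by simp
  qed (use inj \<tau>(2) budget in auto)
qed

subsection \<open>The expected value of the Reduction Algorithm\<close>

text \<open>Fubini, integrating out the coin first; the uniform bound supplies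
  integrability.\<close>

lemma integral_pair_bernoulli:
  fixes f :: "'s \<Rightarrow> bool \<Rightarrow> real"
  assumes "prob_space M" "0 \<le> p" "p \<le> 1"
    and [measurable]: "\<And>b. (\<lambda>\<omega>. f \<omega> b) \<in> borel_measurable M"
    and bound: "\<And>\<omega> b. \<bar>f \<omega> b\<bar> \<le> B"
  shows "(LINT s|(M \<Otimes>\<^sub>M measure_pmf (bernoulli_pmf p)). f (fst s) (snd s))
    = p * (LINT \<omega>|M. f \<omega> True) + (1 - p) * (LINT \<omega>|M. f \<omega> False)"
proof -
  interpret M: prob_space M by fact
  let ?B = "measure_pmf (bernoulli_pmf p)"
  interpret B: prob_space ?B by (rule prob_space_measure_pmf)
  interpret P: pair_prob_space M ?B ..
  \<comment> \<open>The case split on the coin reduces joint measurability to measurability in the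
    seed for each fixed \<open>b\<close>.\<close>
  have "(\<lambda>s. if snd s then f (fst s) True else f (fst s) False) \<in> borel_measurable (M \<Otimes>\<^sub>M ?B)"
    by measurable
  also have "(\<lambda>s. if snd s then f (fst s) True else f (fst s) False) = (\<lambda>s. f (fst s) (snd s))"
    by (auto simp: fun_eq_iff)
  finally have "integrable (M \<Otimes>\<^sub>M ?B) (\<lambda>s. f (fst s) (snd s))"
    using bound by (intro P.integrable_const_bound[where B = B]) auto
  from P.integral_fst'[OF this]
  have "(LINT s|(M \<Otimes>\<^sub>M ?B). f (fst s) (snd s)) = (LINT \<omega>|M. f \<omega> True * p + f \<omega> False * (1 - p))"
    using assms(2,3) by simp
  also have "\<dots> = (LINT \<omega>|M. f \<omega> True) * p + (LINT \<omega>|M. f \<omega> False) * (1 - p)"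
    using bound by (subst Bochner_Integration.integral_add)
      (auto intro!: M.integrable_const_bound[where B = B])
  finally show ?thesis by (simp add: mult.commute)
qed

text \<open>For a fixed order, both subroutines earn full articles, each worth at least its item
  value divided by \<open>C\<close>. The comparison is made seed by seed before integrating.\<close>

lemma reduction_expected_on_arrival:
  fixes A :: "'s knapsack_alg" and as :: "article list"
  assumes "0 < \<alpha>" "knapsack_algorithm A"
    and C: "\<forall>a\<in>set as. item_value (item_of a) \<le> C * real (full_information a)"
  defines "\<delta> \<equiv> \<alpha> / (exp 1 + \<alpha>)" and "n \<equiv> length as"
  shows "\<delta> * (LINT \<omega>|kseeds A n (real T).
        (\<Sum>k\<in>accepted A (real T) \<omega> (map item_of as). item_value (map item_of as ! k)))
    + (1 - \<delta>) * (\<Sum>k<n. if secretary_selects n (take (Suc k) (map (item_value \<circ> item_of) as))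
        then map (item_value \<circ> item_of) as ! k else 0)
    \<le> C * (LINT s|rseeds (reduction \<alpha> A) n T. real (information as ((!) (rao_run (reduction \<alpha> A) T s as))))"
proof -
  let ?M = "kseeds A n (real T)"
  interpret M: prob_space ?M using assms(2) by (simp add: knapsack_algorithm_def)
  have acc [measurable]: "Measurable.pred ?M (\<lambda>\<omega>. accepts A n (real T) \<omega> xs)" for xs
    using assms(2) by (simp add: knapsack_algorithm_def)
  have reads [measurable]: "Measurable.pred ?M (\<lambda>\<omega>. reduction_reads A T (\<omega>, b) as k)" for b k
    by (cases b) (simp_all add: reduction_reads_def acc flip: n_def)
  \<comment> \<open>The parameter \<open>c\<close> is instantiated by the item values and by the
    true information, so both totals run over the same set of read articles.\<close>
  define gain where "gain = (\<lambda>c \<omega> b. \<Sum>k<n. if reduction_reads A T (\<omega>, b) as k then c (as ! k) else (0::real))"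
  have gain_meas [measurable]: "(\<lambda>\<omega>. gain c \<omega> b) \<in> borel_measurable ?M" for b c
    unfolding gain_def by measurable
  have gain_bound: "\<bar>gain c \<omega> b\<bar> \<le> (\<Sum>k<n. \<bar>c (as ! k)\<bar>)" for c \<omega> b
    unfolding gain_def by (rule order.trans[OF sum_abs]) (auto intro!: sum_mono)
  have gain_int: "integrable ?M (\<lambda>\<omega>. gain c \<omega> b)" for c b
    using gain_bound by (intro M.integrable_const_bound[where B = "\<Sum>k<n. \<bar>c (as ! k)\<bar>"]) auto
  let ?val = "\<lambda>a. item_value (item_of a)" and ?inf = "\<lambda>a. real (full_information a)"
  have le: "(LINT \<omega>|?M. gain ?val \<omega> b) \<le> C * (LINT \<omega>|?M. gain ?inf \<omega> b)" for b
  proof -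
    have "(LINT \<omega>|?M. gain ?val \<omega> b) \<le> (LINT \<omega>|?M. C * gain ?inf \<omega> b)"
    proof (rule integral_mono)
      fix \<omega>
      show "gain ?val \<omega> b \<le> C * gain ?inf \<omega> b"
        unfolding gain_def sum_distrib_left using C by (intro sum_mono) (auto simp: n_def)
    qed (use gain_int in auto)
    then show ?thesis by simp
  qed
  have \<delta>: "0 \<le> \<delta>" "\<delta> \<le> 1" using assms(1) by (auto simp: \<delta>_def add_pos_pos field_simps)
  have rseeds: "rseeds (reduction \<alpha> A) n T = ?M \<Otimes>\<^sub>M measure_pmf (bernoulli_pmf \<delta>)"
    by (simp add: reduction_def \<delta>_def)
  have "(LINT s|rseeds (reduction \<alpha> A) n T. real (information as ((!) (rao_run (reduction \<alpha> A) T s as))))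
      = (LINT s|(?M \<Otimes>\<^sub>M measure_pmf (bernoulli_pmf \<delta>)). gain ?inf (fst s) (snd s))"
    unfolding rseeds information_reduction gain_def by (simp add: n_def if_distrib cong: if_cong)
  also have "\<dots> = \<delta> * (LINT \<omega>|?M. gain ?inf \<omega> True) + (1 - \<delta>) * (LINT \<omega>|?M. gain ?inf \<omega> False)"
    by (rule integral_pair_bernoulli) (use \<delta> gain_bound M.prob_space_axioms in auto)
  finally have "C * (LINT s|rseeds (reduction \<alpha> A) n T. real (information as ((!) (rao_run (reduction \<alpha> A) T s as))))
      = \<delta> * (C * (LINT \<omega>|?M. gain ?inf \<omega> True)) + (1 - \<delta>) * (C * (LINT \<omega>|?M. gain ?inf \<omega> False))"
    by (simp only: distrib_left mult.left_commute)
  also have "\<dots> \<ge> \<delta> * (LINT \<omega>|?M. gain ?val \<omega> True) + (1 - \<delta>) * (LINT \<omega>|?M. gain ?val \<omega> False)"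
    using \<delta> le by (intro add_mono mult_left_mono) auto
  moreover have "gain ?val \<omega> True = (\<Sum>k\<in>accepted A (real T) \<omega> (map item_of as). item_value (map item_of as ! k))" for \<omega>
  proof -
    have "accepted A (real T) \<omega> (map item_of as) = {k \<in> {..<n}. reduction_reads A T (\<omega>, True) as k}"
      by (auto simp: accepted_def reduction_reads_def n_def)
    then show ?thesis
      unfolding gain_def by (simp only: sum.inter_filter[OF finite_lessThan, symmetric])
        (auto intro!: sum.cong simp: n_def)
  qed
  moreover have "gain ?val \<omega> False = (\<Sum>k<n. if secretary_selects n (take (Suc k) (map (item_value \<circ> item_of) as))
        then map (item_value \<circ> item_of) as ! k else 0)" for \<omega>
    unfolding gain_def by (intro sum.cong) (auto simp: reduction_reads_def n_def)
  \<comment> \<open>The secretary gain does not depend on the seed, so its integral over a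
    probability space is the gain itself.\<close>
  ultimately show ?thesis by (simp add: M.prob_space)
qed

lemma arrive_map:
  assumes "\<pi> \<in> permutations_of_set {..<length I}"
  shows "arrive (map f I) \<pi> = map f (arrive I \<pi>)"
  using permutations_of_setD(1)[OF assms] by (auto simp: arrive_def)

text \<open>The articles are the same in every order, so one accuracy bound serves all orders and
  the previous inequality can be averaged.\<close>

lemma reduction_expected:
  fixes A :: "'s knapsack_alg"
  assumes "0 < \<alpha>" "knapsack_algorithm A" "rao_instance T I"
  defines "\<delta> \<equiv> \<alpha> / (exp 1 + \<alpha>)" and "n \<equiv> length I" and "vs \<equiv> map (item_value \<circ> item_of) I"
  shows "\<delta> * knapsack_expected A (real T) (map item_of I)
    + (1 - \<delta>) * measure_pmf.expectation (arrival_order n)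
        (\<lambda>\<pi>. \<Sum>k<n. if secretary_selects n (take (Suc k) (arrive vs \<pi>)) then arrive vs \<pi> ! k else 0)
    \<le> hint_accuracy I * rao_expected (reduction \<alpha> A) T I"
proof -
  let ?P = "permutations_of_set {..<n}"
  let ?K = "\<lambda>\<pi>. LINT \<omega>|kseeds A n (real T).
    (\<Sum>k\<in>accepted A (real T) \<omega> (arrive (map item_of I) \<pi>). item_value (arrive (map item_of I) \<pi> ! k))"
  let ?S = "\<lambda>\<pi>. \<Sum>k<n. if secretary_selects n (take (Suc k) (arrive vs \<pi>)) then arrive vs \<pi> ! k else 0"
  let ?R = "\<lambda>\<pi>. LINT s|rseeds (reduction \<alpha> A) n T.
    real (information (arrive I \<pi>) ((!) (rao_run (reduction \<alpha> A) T s (arrive I \<pi>))))"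
  have "\<delta> * ?K \<pi> + (1 - \<delta>) * ?S \<pi> \<le> hint_accuracy I * ?R \<pi>" if \<pi>: "\<pi> \<in> ?P" for \<pi>
  proof -
    have len: "length (arrive I \<pi>) = n"
      using length_finite_permutations_of_set[OF \<pi>] by (simp add: arrive_def)
    have "set (arrive I \<pi>) = (!) I ` {..<length I}"
      unfolding arrive_def set_map permutations_of_setD(1)[OF \<pi>] n_def ..
    then have "set (arrive I \<pi>) \<subseteq> set I" by (simp add: image_subset_iff)
    then have "\<forall>a\<in>set (arrive I \<pi>).
        item_value (item_of a) \<le> hint_accuracy I * real (full_information a)"
      using hint_accuracy_properties(2)[OF assms(3)] by auto
    note bound = reduction_expected_on_arrival[OF assms(1,2) this, of T]
    have "arrive (map item_of I) \<pi> = map item_of (arrive I \<pi>)"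
      "arrive vs \<pi> = map (item_value \<circ> item_of) (arrive I \<pi>)"
      using \<pi> unfolding vs_def n_def by (rule arrive_map)+
    then show ?thesis using bound unfolding len \<delta>_def by (simp only:)
  qed
  then have "(\<Sum>\<pi>\<in>?P. \<delta> * ?K \<pi> + (1 - \<delta>) * ?S \<pi>) / fact n \<le> (\<Sum>\<pi>\<in>?P. hint_accuracy I * ?R \<pi>) / fact n"
    by (intro divide_right_mono sum_mono) auto
  then show ?thesis
    by (simp only: knapsack_expected_def rao_expected_def expectation_arrival_order n_def length_map
        sum.distrib add_divide_distrib times_divide_eq_right sum_distrib_left[symmetric])
qed

theorem theorem1:
  fixes \<alpha> :: real and Alg :: "'s knapsack_alg"
  assumes "\<alpha> > 0"
    and "knapsack_competitive \<alpha> Alg"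
  shows "rao_algorithm (reduction \<alpha> Alg) \<and>
    (\<forall>T I C. rao_instance T I \<and> C = hint_accuracy I \<longrightarrow>
       rao_expected (reduction \<alpha> Alg) T I \<ge> real (rao_opt T I) / ((exp 1 + \<alpha>) * C))"
proof (intro conjI allI impI)
  have alg: "knapsack_algorithm Alg"
    and comp: "\<And>W I. knapsack_instance W I \<Longrightarrow> knapsack_opt W I / \<alpha> \<le> knapsack_expected Alg W I"
    using assms(2) by (auto simp: knapsack_competitive_def)
  show "rao_algorithm (reduction \<alpha> Alg)" using alg by (rule rao_algorithm_reduction)
  fix T I C
  assume "rao_instance T I \<and> C = hint_accuracy I"
  then have I: "rao_instance T I" and C: "C = hint_accuracy I" by auto
  have C1: "1 \<le> C" using hint_accuracy_properties(1)[OF I] C by simp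
  show "real (rao_opt T I) / ((exp 1 + \<alpha>) * C) \<le> rao_expected (reduction \<alpha> Alg) T I"
  proof (cases "I = []")
    \<comment> \<open>With no articles the optimum is \<open>0\<close>; this case is separate
      because \<open>v\<close> below is a maximum over the articles.\<close>
    case True
    obtain \<tau> where "rao_opt T I = information I \<tau>" using rao_opt_attained[of T I] by blast
    then show ?thesis
      using True by (simp add: information_def rao_expected_def arrival_order_def arrive_def pmf_of_set_singleton)
  next
    case False
    let ?K = "knapsack_opt (real T) (map item_of I)"
    define vs where "vs = map (item_value \<circ> item_of) I"
    define v where "v = Max (set vs)"
    define \<delta> where "\<delta> = \<alpha> / (exp 1 + \<alpha>)"
    define S where "S = measure_pmf.expectation (arrival_order (length I)) (\<lambda>\<pi>. \<Sum>k<length I.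
      if secretary_selects (length I) (take (Suc k) (arrive vs \<pi>)) then arrive vs \<pi> ! k else 0)"
    have vs: "finite (set vs)" "set vs \<noteq> {}" using False by (auto simp: vs_def)
    obtain a where a: "a \<in> set I" "real (rao_opt T I) \<le> ?K + item_value (item_of a)"
      by (rule rao_opt_le_knapsack_opt[OF I False])
    have "item_value (item_of a) \<le> v" unfolding v_def using a(1) vs by (intro Max_ge) (auto simp: vs_def)
    then have opt: "real (rao_opt T I) \<le> ?K + v" using a(2) by simp
    \<comment> \<open>The secretary bound requires distinct values, which come from the pairwise
      distinct products of length and hint.\<close>
    have "vs = map real (map (\<lambda>a. len a * hint a) I)" by (simp add: vs_def)
    moreover have "distinct (map (\<lambda>a. len a * hint a) I)" using I by (simp add: rao_instance_def)
    ultimately have "distinct vs" by (simp only: distinct_map) (auto intro: inj_onI)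
    moreover have "v \<in> set vs" unfolding v_def using vs by (rule Max_in)
    moreover have "0 \<le> x \<and> x \<le> v" if "x \<in> set vs" for x
      using that vs(1) by (auto simp: v_def vs_def)
    ultimately have "v / exp 1 \<le> S"
      using secretary_competitive[of vs v] by (simp add: S_def vs_def)
    moreover have "?K / \<alpha> \<le> knapsack_expected Alg (real T) (map item_of I)"
      by (intro comp rao_instance_knapsack I)
    moreover have \<delta>: "0 \<le> \<delta>" "0 \<le> 1 - \<delta>" using assms(1) by (auto simp: \<delta>_def add_pos_pos field_simps)
    ultimately have "\<delta> * (?K / \<alpha>) + (1 - \<delta>) * (v / exp 1)
        \<le> \<delta> * knapsack_expected Alg (real T) (map item_of I) + (1 - \<delta>) * S"
      by (intro add_mono mult_left_mono)
    also have "\<dots> \<le> C * rao_expected (reduction \<alpha> Alg) T I"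
      using reduction_expected[OF assms(1) alg I] unfolding C \<delta>_def S_def vs_def .
    finally have "\<delta> * (?K / \<alpha>) + (1 - \<delta>) * (v / exp 1) \<le> C * rao_expected (reduction \<alpha> Alg) T I" .
    moreover have "\<delta> * (?K / \<alpha>) + (1 - \<delta>) * (v / exp 1) = (?K + v) / (exp 1 + \<alpha>)"
    proof -
      have "exp 1 + \<alpha> > 0" using assms(1) by (simp add: add_pos_pos)
      then have "\<delta> / \<alpha> = 1 / (exp 1 + \<alpha>)" "(1 - \<delta>) / exp 1 = 1 / (exp 1 + \<alpha>)"
        using assms(1) by (simp_all add: \<delta>_def diff_divide_eq_iff divide_simps)
      moreover have "\<delta> * (?K / \<alpha>) + (1 - \<delta>) * (v / exp 1) = \<delta> / \<alpha> * ?K + (1 - \<delta>) / exp 1 * v" by simp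
      ultimately show ?thesis by (simp add: add_divide_distrib)
    qed
    moreover have "real (rao_opt T I) / (exp 1 + \<alpha>) \<le> (?K + v) / (exp 1 + \<alpha>)"
      using opt assms(1) by (intro divide_right_mono) (auto simp: add_nonneg_nonneg)
    ultimately have "real (rao_opt T I) / (exp 1 + \<alpha>) \<le> C * rao_expected (reduction \<alpha> Alg) T I" by simp
    then show ?thesis
      unfolding divide_divide_eq_left[symmetric] using C1
      by (subst pos_divide_le_eq) (auto simp: mult.commute)
  qed
qed

end
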